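(* Assume that $J$ and $f$ satisfy the standing assumptions listed in the context, and let $u(t,x)$ and $X(t)$ be the transition front and the function described in the context. Then, for any $M>0$, $$\sup_{t\in\mathbb{R}}\ \sup_{x\in[X(t)-M,X(t)+M]}u_x(t,x)<0 .$$
   Context: Equation. Consider $u_t=J*u-u+f(t,u)$, $(t,x)\in\mathbb{R}\times\mathbb{R}$, where $[J*u](t,x)=\int_{\mathbb{R}}J(x-y)u(t,y)\,dy$. Assumptions on $J$: $J\not\equiv 0$, $J\in C^1(\mathbb{R})$, $J(x)=J(-x)\ge 0$ for all $x$, $\int_{\mathbb{R}}J(x)dx=1$, $\int_{\mathbb{R}}|J'(x)|dx<\infty$, and $\int_{\mathbb{R}}J(x)e^{\lambda x}dx<\infty$ for all $\lambda>0$. Assumptions on $f$: $f:\mathbb{R}\times[0,\infty)\to\mathbb{R}$ is continuously differentiable and (a) there are $\theta\in(0,1)$, $f_{\min}\in C^{1,\gamma}([0,1])$ (for some Hölder exponent $\gamma$) and a Lipschitz function $f_{\max}:[0,1]\to\mathbb{R}$ with $f_{\min}(w)=f_{\max}(w)=0$ for $w\in[0,\theta]\cup\{1\}$, $0<f_{\min}(w)\le f_{\max}(w)$ for $w\in(\theta,1)$, $f_{\min}'(1)<0$, such that $f_{\min}(w)\le f(t,w)\le f_{\max}(w)$ for $(t,w)\in\mathbb{R}\times[0,1]$; (b) $f(t,w)<0$ for $(t,w)\in\mathbb{R}\times(1,\infty)$; (c) $\sup_{\mathbb{R}\times[0,1]}|f_t|<\infty$ and $\sup_{\mathbb{R}\times[0,\infty)}|f_u|<\infty$;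 (d) there is $\tilde\theta\in(\theta,1)$ with $f_u(t,w)\le 0$ for all $t\in\mathbb{R}$, $w\in[\tilde\theta,1]$; (e) $f(t,u)$ is twice continuously differentiable in $u$ and $\sup_{\mathbb{R}\times[0,1]}|f_{uu}|<\infty$. Approximating solutions (known facts). There are a unique $c^*_{\min}>0$ and a unique $C^1$ function $\phi_{\min}:\mathbb{R}\to(0,1)$ with $J*\phi_{\min}-\phi_{\min}+c^*_{\min}\phi_{\min}'+f_{\min}(\phi_{\min})=0$, $\phi_{\min}'<0$, $\phi_{\min}(0)=\theta$, $\phi_{\min}(-\infty)=1$, $\phi_{\min}(\infty)=0$. For each $s<0$ there is a unique $y_s\in\mathbb{R}$ (with $y_s\to-\infty$ as $s\to-\infty$) such that the classical solution $u(t,x;s)$, $t\ge s$, of the equation with $u(s,x;s)=\phi_{\min}(x-y_s)$ satisfies $u(0,0;s)=\theta$. Each $u(t,x;s)$ is strictly decreasing in $x$ with $u(t,-\infty;s)=1$, $u(t,\infty;s)=0$; for $\lambda\in(0,1)$ let $X_\lambda(t;s)$ be the point with $u(t,X_\lambda(t;s);s)=\lambda$. There are positive constants $c_{\min},c_{\max},c_\pm,h_\pm$ (independent of $s$) and twice continuously differentiable functions $X(\cdot;s):[s,\infty)\to\mathbb{R}$ such that, for all $s<0$, $t\ge s$: $c_{\min}\le\dot X(t;s)\le c_{\max}$; $\sup_{s<0,t\ge s}|\ddot X(t;s)|<\infty$; $\sup_{s<0,t\ge s}|X(t;s)-X_\lambda(t;s)|<\infty$ for every $\lambda\in(0,1)$;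 $u(t,x;s)\ge 1-e^{c_-(x-X(t;s)+h_-)}$ for $x\le X(t;s)-h_-$; $u(t,x;s)\le e^{-c_+(x-X(t;s)-h_+)}$ for $x\ge X(t;s)+h_+$. Moreover $u(t,x;s)$ is Lipschitz in $x$ uniformly in $s<0$, $t\ge s$. The transition front. A transition front is an entire solution $u$ with $u(t,-\infty)=1$, $u(t,\infty)=0$ for all $t$ and $\sup_{t\in\mathbb{R}}\mathrm{diam}\{x:\epsilon\le u(t,x)\le 1-\epsilon\}<\infty$ for every $\epsilon\in(0,1)$. Throughout, $u(t,x)$ is the transition front and $X:\mathbb{R}\to\mathbb{R}$ the continuously differentiable function obtained as limits: $X(t;s)\to X(t)$, $u(t,x;s)\to u(t,x)$, $u_t(t,x;s)\to u_t(t,x)$ locally uniformly in $(t,x)\in\mathbb{R}\times\mathbb{R}$ as $s\to-\infty$ along some subsequence. It is known that $u$ is strictly decreasing in $x$ and Lipschitz in $x$ uniformly in $t$, that $\dot X(t)\in[c_{\min},c_{\max}]$ for all $t\in\mathbb{R}$, and that, for all $t\in\mathbb{R}$, $u(t,x)\ge 1-e^{c_-(x-X(t)+h_-)}$ for $x\le X(t)-h_-$ and $u(t,x)\le e^{-c_+(x-X(t)-h_+)}$ for $x\ge X(t)+h_+$. When $J$ has all the properties listed in this context under "Assumptions on $J$" and $f$ has properties (a)–(e) listed in this context under "Assumptions on $f$", $u(t,x)$ is continuously differentiable in $x$, so $u_x$ makes sense. *)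

theory Defs
  imports "HOL-Analysis.Analysis"
begin

text \<open>
  The nonlocal equation \<open>u_t = J * u - u + f(t,u)\<close> on the line. Functions of time and space are
  curried, \<open>u t x\<close>; families of solutions with initial time \<open>s\<close> are written \<open>v s t x\<close>. The
  nonlinearity is a total function \<open>f t w\<close>, but only its values for \<open>w \<ge> 0\<close> are ever used.
\<close>

text \<open>Derivative relative to a set, one-sided at the end points of an interval.\<close>

definition deriv_within :: "real set \<Rightarrow> (real \<Rightarrow> real) \<Rightarrow> real \<Rightarrow> real" where
  "deriv_within S g x = vector_derivative g (at x within S)"

definition C1_within :: "real set \<Rightarrow> (real \<Rightarrow> real) \<Rightarrow> bool" where
  "C1_within S g \<longleftrightarrow> g differentiable_on S \<and> continuous_on S (deriv_within S g)"

definition C2_within :: "real set \<Rightarrow> (real \<Rightarrow> real) \<Rightarrow> bool" where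
  "C2_within S g \<longleftrightarrow> C1_within S g \<and> C1_within S (deriv_within S g)"

definition dispersal_kernel :: "(real \<Rightarrow> real) \<Rightarrow> bool" where
  "dispersal_kernel J \<longleftrightarrow>
     (\<exists>x. J x \<noteq> 0) \<and>
     J C1_differentiable_on UNIV \<and>
     (\<forall>x. J x = J (- x) \<and> 0 \<le> J x) \<and>
     has_bochner_integral lborel J 1 \<and>
     integrable lborel (\<lambda>x. \<bar>deriv J x\<bar>) \<and>
     (\<forall>l>0. integrable lborel (\<lambda>x. J x * exp (l * x)))"

text \<open>Partial derivatives of \<open>f\<close> on \<open>\<real> \<times> [0,\<infinity>)\<close>; those in \<open>w\<close> are one-sided at \<open>w = 0\<close>.\<close>

definition d_t :: "(real \<Rightarrow> real \<Rightarrow> real) \<Rightarrow> real \<Rightarrow> real \<Rightarrow> real" where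
  "d_t f t w = deriv (\<lambda>\<tau>. f \<tau> w) t"

definition d_w :: "(real \<Rightarrow> real \<Rightarrow> real) \<Rightarrow> real \<Rightarrow> real \<Rightarrow> real" where
  "d_w f t w = deriv_within {0..} (f t) w"

definition C1_half_plane :: "(real \<Rightarrow> real \<Rightarrow> real) \<Rightarrow> bool" where
  "C1_half_plane f \<longleftrightarrow>
     (\<lambda>(t, w). f t w) differentiable_on (UNIV \<times> {0..}) \<and>
     continuous_on (UNIV \<times> {0..}) (\<lambda>(t, w). d_t f t w) \<and>
     continuous_on (UNIV \<times> {0..}) (\<lambda>(t, w). d_w f t w)"

definition C1_hoelder_unit :: "(real \<Rightarrow> real) \<Rightarrow> bool" where
  "C1_hoelder_unit g \<longleftrightarrow>
     C1_within {0..1} g \<and>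
     (\<exists>\<gamma> K. 0 < \<gamma> \<and> \<gamma> \<le> 1 \<and>
        (\<forall>a\<in>{0..1}. \<forall>b\<in>{0..1}.
           \<bar>deriv_within {0..1} g a - deriv_within {0..1} g b\<bar> \<le> K * \<bar>a - b\<bar> powr \<gamma>))"

definition ignition_nonlinearity ::
  "(real \<Rightarrow> real \<Rightarrow> real) \<Rightarrow> real \<Rightarrow> (real \<Rightarrow> real) \<Rightarrow> bool" where
  "ignition_nonlinearity f \<theta> fmin \<longleftrightarrow>
     C1_half_plane f \<and>
     0 < \<theta> \<and> \<theta> < 1 \<and>
     C1_hoelder_unit fmin \<and> deriv_within {0..1} fmin 1 < 0 \<and>
     (\<exists>fmax. (\<exists>L. L-lipschitz_on {0..1} fmax) \<and>
        (\<forall>w\<in>{0..\<theta>} \<union> {1}. fmin w = 0 \<and> fmax w = 0) \<and>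
        (\<forall>w\<in>{\<theta><..<1}. 0 < fmin w \<and> fmin w \<le> fmax w) \<and>
        (\<forall>t. \<forall>w\<in>{0..1}. fmin w \<le> f t w \<and> f t w \<le> fmax w)) \<and>
     (\<forall>t. \<forall>w>1. f t w < 0) \<and>
     bdd_above ((\<lambda>(t, w). \<bar>d_t f t w\<bar>) ` (UNIV \<times> {0..1})) \<and>
     bdd_above ((\<lambda>(t, w). \<bar>d_w f t w\<bar>) ` (UNIV \<times> {0..})) \<and>
     (\<exists>\<theta>'. \<theta> < \<theta>' \<and> \<theta>' < 1 \<and> (\<forall>t. \<forall>w\<in>{\<theta>'..1}. d_w f t w \<le> 0)) \<and>
     (\<forall>t. C2_within {0..} (f t)) \<and>
     bdd_above ((\<lambda>(t, w). \<bar>d_w (d_w f) t w\<bar>) ` (UNIV \<times> {0..1}))"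

definition conv :: "(real \<Rightarrow> real) \<Rightarrow> (real \<Rightarrow> real) \<Rightarrow> real \<Rightarrow> real" where
  "conv J g x = (\<integral>y. J (x - y) * g y \<partial>lborel)"

text \<open>
  Classical (nonnegative) solutions for times in \<open>T\<close>. Integrability is required explicitly because
  the Bochner integral of a non-integrable function is \<open>0\<close>.
\<close>

definition classical_solution ::
  "(real \<Rightarrow> real) \<Rightarrow> (real \<Rightarrow> real \<Rightarrow> real) \<Rightarrow> real set \<Rightarrow> (real \<Rightarrow> real \<Rightarrow> real) \<Rightarrow> bool" where
  "classical_solution J f T u \<longleftrightarrow>
     continuous_on (T \<times> UNIV) (\<lambda>(t, x). u t x) \<and>
     (\<forall>t\<in>T. \<forall>x. 0 \<le> u t x \<and> integrable lborel (\<lambda>y. J (x - y) * u t y)) \<and>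
     (\<exists>u_t. continuous_on (T \<times> UNIV) (\<lambda>(t, x). u_t t x) \<and>
        (\<forall>t\<in>T. \<forall>x.
           ((\<lambda>\<tau>. u \<tau> x) has_real_derivative u_t t x) (at t within T) \<and>
           u_t t x = conv J (u t) x - u t x + f t (u t x)))"

definition transition_front ::
  "(real \<Rightarrow> real) \<Rightarrow> (real \<Rightarrow> real \<Rightarrow> real) \<Rightarrow> (real \<Rightarrow> real \<Rightarrow> real) \<Rightarrow> bool" where
  "transition_front J f u \<longleftrightarrow>
     classical_solution J f UNIV u \<and>
     (\<forall>t. (u t \<longlongrightarrow> 1) at_bot \<and> (u t \<longlongrightarrow> 0) at_top) \<and>
     (\<forall>\<epsilon>. 0 < \<epsilon> \<and> \<epsilon> < 1 \<longrightarrow>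
        (\<forall>t. bounded {x. \<epsilon> \<le> u t x \<and> u t x \<le> 1 - \<epsilon>}) \<and>
        bdd_above (range (\<lambda>t. diameter {x. \<epsilon> \<le> u t x \<and> u t x \<le> 1 - \<epsilon>})))"

text \<open>Traveling wave of speed \<open>c\<close> for the homogeneous nonlinearity \<open>fmin\<close>, normalized at \<open>0\<close>.\<close>

definition minimal_wave ::
  "(real \<Rightarrow> real) \<Rightarrow> (real \<Rightarrow> real) \<Rightarrow> real \<Rightarrow> real \<Rightarrow> (real \<Rightarrow> real) \<Rightarrow> bool" where
  "minimal_wave J fmin \<theta> c \<phi> \<longleftrightarrow>
     0 < c \<and>
     \<phi> C1_differentiable_on UNIV \<and>
     (\<forall>x. 0 < \<phi> x \<and> \<phi> x < 1) \<and>
     (\<forall>x. conv J \<phi> x - \<phi> x + c * deriv \<phi> x + fmin (\<phi> x) = 0) \<and>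
     (\<forall>x. deriv \<phi> x < 0) \<and>
     \<phi> 0 = \<theta> \<and>
     (\<phi> \<longlongrightarrow> 1) at_bot \<and> (\<phi> \<longlongrightarrow> 0) at_top"

text \<open>
  The approximating solutions \<open>v s\<close> start at time \<open>s < 0\<close> from the wave shifted by \<open>y s\<close>, which is
  chosen so that \<open>v s 0 0 = \<theta>\<close>. The last three conjuncts are known properties of them.
\<close>

definition approximating_solutions ::
  "(real \<Rightarrow> real) \<Rightarrow> (real \<Rightarrow> real \<Rightarrow> real) \<Rightarrow> real \<Rightarrow> (real \<Rightarrow> real) \<Rightarrow> (real \<Rightarrow> real) \<Rightarrow>
   (real \<Rightarrow> real \<Rightarrow> real \<Rightarrow> real) \<Rightarrow> bool" where
  "approximating_solutions J f \<theta> \<phi> y v \<longleftrightarrow>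
     (\<forall>s<0. classical_solution J f {s..} (v s) \<and>
            (\<forall>x. v s s x = \<phi> (x - y s)) \<and>
            v s 0 0 = \<theta>) \<and>
     filterlim y at_bot at_bot \<and>
     (\<forall>s<0. \<forall>t\<ge>s. strict_antimono_on UNIV (v s t) \<and>
            (v s t \<longlongrightarrow> 1) at_bot \<and> (v s t \<longlongrightarrow> 0) at_top) \<and>
     (\<exists>L. \<forall>s<0. \<forall>t\<ge>s. L-lipschitz_on UNIV (v s t))"

text \<open>For a strictly decreasing profile \<open>g\<close>, the point where it takes the value \<open>l\<close>.\<close>

definition level_point :: "(real \<Rightarrow> real) \<Rightarrow> real \<Rightarrow> real" where
  "level_point g l = (THE x. g x = l)"

definition exp_bounds ::
  "real \<Rightarrow> real \<Rightarrow> real \<Rightarrow> real \<Rightarrow> (real \<Rightarrow> real) \<Rightarrow> real \<Rightarrow> bool" where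
  "exp_bounds cm cp hm hp g X \<longleftrightarrow>
     (\<forall>x \<le> X - hm. g x \<ge> 1 - exp (cm * (x - X + hm))) \<and>
     (\<forall>x \<ge> X + hp. g x \<le> exp (- cp * (x - X - hp)))"

text \<open>
  Known properties of the interface locations \<open>Y s t\<close> of the approximating solutions; \<open>cm\<close>, \<open>cp\<close>,
  \<open>hm\<close>, \<open>hp\<close> are the decay rates and shifts behind (minus) and ahead of (plus) the interface.
\<close>

definition approximating_interfaces ::
  "(real \<Rightarrow> real \<Rightarrow> real \<Rightarrow> real) \<Rightarrow> (real \<Rightarrow> real \<Rightarrow> real) \<Rightarrow>
   real \<Rightarrow> real \<Rightarrow> real \<Rightarrow> real \<Rightarrow> real \<Rightarrow> real \<Rightarrow> bool" where
  "approximating_interfaces v Y cmin cmax cm cp hm hp \<longleftrightarrow>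
     0 < cmin \<and> 0 < cmax \<and> 0 < cm \<and> 0 < cp \<and> 0 < hm \<and> 0 < hp \<and>
     (\<forall>s<0. C2_within {s..} (Y s)) \<and>
     (\<forall>s<0. \<forall>t\<ge>s. deriv_within {s..} (Y s) t \<in> {cmin..cmax}) \<and>
     bdd_above ((\<lambda>(s, t). \<bar>deriv_within {s..} (deriv_within {s..} (Y s)) t\<bar>)
                  ` {(s, t). s < 0 \<and> s \<le> t}) \<and>
     (\<forall>l. 0 < l \<and> l < 1 \<longrightarrow>
        bdd_above ((\<lambda>(s, t). \<bar>Y s t - level_point (v s t) l\<bar>) ` {(s, t). s < 0 \<and> s \<le> t})) \<and>
     (\<forall>s<0. \<forall>t\<ge>s. exp_bounds cm cp hm hp (v s t) (Y s t))"

text \<open>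
  Locally uniform convergence along a sequence of initial times tending to \<open>-\<infinity>\<close>. On a compact set
  \<open>v s\<close> and \<open>Y s\<close> are defined by the equation as soon as \<open>s\<close> is below all its times.
\<close>

definition front_limit ::
  "(real \<Rightarrow> real \<Rightarrow> real \<Rightarrow> real) \<Rightarrow> (real \<Rightarrow> real \<Rightarrow> real) \<Rightarrow>
   (real \<Rightarrow> real \<Rightarrow> real) \<Rightarrow> (real \<Rightarrow> real) \<Rightarrow> bool" where
  "front_limit v Y u X \<longleftrightarrow>
     (\<exists>s :: nat \<Rightarrow> real. (\<forall>n. s n < 0) \<and> filterlim s at_bot sequentially \<and>
        (\<forall>K. compact K \<longrightarrow> uniform_limit K (\<lambda>n t. Y (s n) t) X sequentially) \<and>
        (\<forall>K. compact K \<longrightarrow>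
           uniform_limit K (\<lambda>n (t, x). v (s n) t x) (\<lambda>(t, x). u t x) sequentially) \<and>
        (\<forall>K. compact K \<longrightarrow>
           uniform_limit K (\<lambda>n (t, x). deriv (\<lambda>\<tau>. v (s n) \<tau> x) t)
             (\<lambda>(t, x). deriv (\<lambda>\<tau>. u \<tau> x) t) sequentially))"

text \<open>Known properties of the limiting front \<open>u\<close> and interface \<open>X\<close>.\<close>

definition front_properties ::
  "(real \<Rightarrow> real \<Rightarrow> real) \<Rightarrow> (real \<Rightarrow> real) \<Rightarrow>
   real \<Rightarrow> real \<Rightarrow> real \<Rightarrow> real \<Rightarrow> real \<Rightarrow> real \<Rightarrow> bool" where
  "front_properties u X cmin cmax cm cp hm hp \<longleftrightarrow>
     X C1_differentiable_on UNIV \<and>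
     (\<forall>t. deriv X t \<in> {cmin..cmax}) \<and>
     (\<forall>t. strict_antimono_on UNIV (u t)) \<and>
     (\<exists>L. \<forall>t. L-lipschitz_on UNIV (u t)) \<and>
     (\<forall>t. exp_bounds cm cp hm hp (u t) (X t)) \<and>
     (\<forall>t. u t C1_differentiable_on UNIV)"

end

theory Submission
  imports Defs
begin

text \<open>
  Where the front is steep in the mean, it is steep at every point a moment later. The quantity
  that carries the argument is the gap \<open>u t p - u t q \<ge> 0\<close> between two points \<open>p < q\<close>. The gap
  \<open>w\<close> between \<open>x\<close> and \<open>x + h\<close> satisfies \<open>w_t \<ge> J * w - a w\<close>, where \<open>a - 1\<close> is a
  Lipschitz constant of \<open>f\<close> in its second argument. Dispersal therefore creates, within any
  time \<open>\<tau>\<close>, a gap of size proportional to \<open>h\<close> at \<open>x\<close> out of the gap over an interval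
  from which \<open>x\<close> is reached by jumps of positive density (\<open>gap_transfer\<close>). Gaps, unlike \<open>u_x\<close>, are governed by the
  equation itself, with no derivative of it in space, and as the bound is linear in \<open>h\<close>, it
  passes to the derivative at the end.

  As \<open>J\<close> is symmetric and positive on some interval, two steps, one in each direction, lead
  back to a whole neighbourhood of \<open>x\<close>, and after \<open>n\<close> double steps the gap at \<open>x\<close> is controlled
  from below by the gap over an interval of radius proportional to \<open>n\<close> (\<open>gap_spreading\<close>). The
  step \<open>\<tau>\<close> can be as short as desired. Hence \<open>n\<close> can be chosen so large that this interval
  contains the whole transition zone, and then \<open>\<tau> = 1 / (2 n)\<close>, so that the zone moves by at
  most \<open>cmax\<close> in the meantime. Over the transition zone the gap is at least \<open>1 / 2\<close> by the
  exponential bounds, uniformly in time.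
\<close>

section \<open>The nonlocal term\<close>

text \<open>By continuity at a point where \<open>J\<close> does not vanish; the reflected bound is symmetry.\<close>

lemma dispersal_kernel_positive_on_interval:
  assumes "dispersal_kernel J"
  obtains \<alpha> \<beta> \<kappa> where "\<alpha> < \<beta>" "0 < \<kappa>"
    "\<And>z. z \<in> {\<alpha>..\<beta>} \<Longrightarrow> \<kappa> \<le> J z" "\<And>z. z \<in> {-\<beta>..-\<alpha>} \<Longrightarrow> \<kappa> \<le> J z"
proof -
  have sym: "\<And>z. J z = J (- z)" and nonneg: "\<And>z. 0 \<le> J z"
    using assms unfolding dispersal_kernel_def by blast+
  obtain z0 where "J z0 \<noteq> 0"
    using assms unfolding dispersal_kernel_def by blast
  with nonneg[of z0] have pos: "0 < J z0" by simp
  have "J C1_differentiable_on UNIV"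
    using assms unfolding dispersal_kernel_def by blast
  then have "continuous_on UNIV J"
    by (rule C1_differentiable_imp_continuous_on)
  then have "isCont J z0"
    by (simp add: continuous_on_eq_continuous_at)
  then obtain d where d: "0 < d" "\<And>z. dist z z0 < d \<Longrightarrow> dist (J z) (J z0) < J z0 / 2"
    using pos unfolding continuous_at_eps_delta
    by (metis half_gt_zero)
  have near: "J z0 / 2 \<le> J z" if "z \<in> {z0..z0 + d / 2}" for z
    using d(2)[of z] d(1) that by (auto simp: dist_real_def abs_if split: if_splits)
  show ?thesis
  proof (rule that[of z0 "z0 + d / 2" "J z0 / 2"])
    show "J z0 / 2 \<le> J z" if "z \<in> {- (z0 + d / 2)..- z0}" for z
      using near[of "- z"] sym[of z] that by auto
  qed (use near pos d in auto)
qed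

text \<open>
  The two integrals over \<open>[p, q]\<close> and \<open>[p + h, q + h]\<close> differ only by the end pieces
  \<open>[p, p + h]\<close> and \<open>[q, q + h]\<close>, where monotonicity compares \<open>g\<close> with constants. This is the step
  that makes the estimates linear in \<open>h\<close>.
\<close>

lemma integral_gap_of_antimono:
  fixes g :: "real \<Rightarrow> real"
  assumes "continuous_on UNIV g" "antimono g" "p \<le> q" "0 \<le> h"
  shows "h * (g (p + h) - g q) \<le> integral {p..q} (\<lambda>z. g z - g (z + h))"
proof -
  have int: "g integrable_on {a..b}" for a b
    by (rule integrable_continuous_real) (rule continuous_on_subset[OF assms(1)], simp)
  have int_shift: "(\<lambda>z. g (z + h)) integrable_on {p..q}"
    by (rule integrable_continuous_real)
      (intro continuous_on_compose2[OF assms(1)] continuous_intros, simp)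
  have shift: "integral {p..q} (\<lambda>z. g (z + h)) = integral {p + h..q + h} g"
    using integral_shift[of p h q g] continuous_on_subset[OF assms(1)]
    by (simp add: o_def add.commute)
  have "integral {p..p + h} g + integral {p + h..q + h} g = integral {p..q + h} g"
    using assms int by (intro Henstock_Kurzweil_Integration.integral_combine) auto
  moreover have "integral {p..q} g + integral {q..q + h} g = integral {p..q + h} g"
    using assms int by (intro Henstock_Kurzweil_Integration.integral_combine) auto
  ultimately have "integral {p..q} (\<lambda>z. g z - g (z + h))
      = integral {p..p + h} g - integral {q..q + h} g"
    using shift by (simp add: Henstock_Kurzweil_Integration.integral_diff[OF int int_shift])
  moreover have "integral {p..p + h} (\<lambda>z. g (p + h)) \<le> integral {p..p + h} g"
    by (intro integral_le int) (auto intro: antimonoD[OF assms(2)])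
  moreover have "integral {q..q + h} g \<le> integral {q..q + h} (\<lambda>z. g q)"
    by (intro integral_le int) (auto intro: antimonoD[OF assms(2)])
  ultimately show ?thesis
    using assms(4) by (simp add: algebra_simps)
qed

lemma conv_gap_lower_bound:
  fixes g J :: "real \<Rightarrow> real"
  assumes cont: "continuous_on UNIV g" and anti: "antimono g"
    and int: "\<And>x. integrable lborel (\<lambda>y. J (x - y) * g y)"
    and nonneg: "\<And>z. 0 \<le> J z" and \<kappa>: "\<And>z. z \<in> {\<alpha>..\<beta>} \<Longrightarrow> \<kappa> \<le> J z"
    and "\<alpha> \<le> \<beta>" "0 \<le> \<kappa>" "0 \<le> h"
  shows "\<kappa> * h * (g (x - \<beta> + h) - g (x - \<alpha>)) \<le> conv J g x - conv J g (x + h)"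
proof -
  \<comment> \<open>Substituting so that the kernel is evaluated at the same point in both convolutions.\<close>
  have int': "integrable lborel (\<lambda>y. J (x - y) * g (y + h))"
    using lborel_integrable_real_affine[OF int[of "x + h"], of 1 h]
    by (simp add: algebra_simps)
  have shift: "conv J g (x + h) = (\<integral>y. J (x - y) * g (y + h) \<partial>lborel)"
    unfolding conv_def
    using lborel_integral_real_affine[of 1 "\<lambda>y. J (x + h - y) * g y" h]
    by (simp add: algebra_simps)
  let ?G = "\<lambda>y. g y - g (y + h)"
  let ?I = "{x - \<beta>..x - \<alpha>}"
  have diff: "conv J g x - conv J g (x + h) = (\<integral>y. J (x - y) * ?G y \<partial>lborel)"
    unfolding shift by (simp add: conv_def right_diff_distrib Bochner_Integration.integral_diff[OF int int'])
  have G_nonneg: "0 \<le> ?G y" for y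
    using antimonoD[OF anti, of y "y + h"] assms by simp
  have G_cont: "continuous_on ?I ?G"
    by (intro continuous_intros continuous_on_compose2[OF cont]) auto
  have G_int: "set_integrable lborel ?I ?G"
    by (rule borel_integrable_atLeastAtMost')(rule G_cont)
  have "\<kappa> * h * (g (x - \<beta> + h) - g (x - \<alpha>)) \<le> \<kappa> * integral ?I ?G"
    using mult_left_mono[OF integral_gap_of_antimono[OF cont anti, of "x - \<beta>" "x - \<alpha>" h] \<open>0 \<le> \<kappa>\<close>]
      assms by (simp add: mult.assoc)
  also have "\<dots> = \<kappa> * (LINT y:?I|lborel. ?G y)"
    using set_borel_integral_eq_integral(2)[OF G_int] by simp
  also have "\<dots> = (\<integral>y. \<kappa> * (indicator ?I y * ?G y) \<partial>lborel)"
    by (simp add: set_lebesgue_integral_def)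
  also have "\<dots> \<le> (\<integral>y. J (x - y) * ?G y \<partial>lborel)"
  proof (rule integral_mono)
    show "integrable lborel (\<lambda>y. \<kappa> * (indicator ?I y * ?G y))"
      using G_int by (simp add: set_integrable_def)
    show "integrable lborel (\<lambda>y. J (x - y) * ?G y)"
      using Bochner_Integration.integrable_diff[OF int int'] by (simp add: right_diff_distrib)
    show "\<kappa> * (indicator ?I y * ?G y) \<le> J (x - y) * ?G y" for y
      using mult_right_mono[OF \<kappa>[of "x - y"] G_nonneg[of y]]
        mult_nonneg_nonneg[OF nonneg[of "x - y"] G_nonneg[of y]]
      by (auto simp: indicator_def)
  qed
  finally show ?thesis unfolding diff .
qed

section \<open>Growth of gaps in time\<close>

lemma ignition_nonlinearity_lipschitz:
  assumes "ignition_nonlinearity f \<theta> fmin"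
  obtains K where "\<And>t a b. 0 \<le> a \<Longrightarrow> 0 \<le> b \<Longrightarrow> \<bar>f t a - f t b\<bar> \<le> K * \<bar>a - b\<bar>"
proof -
  have diff: "f t differentiable_on {0..}" for t
    using assms unfolding ignition_nonlinearity_def C2_within_def C1_within_def by blast
  have "bdd_above ((\<lambda>(t, w). \<bar>d_w f t w\<bar>) ` (UNIV \<times> {0..}))"
    using assms unfolding ignition_nonlinearity_def by (elim conjE)
  then obtain K where K: "\<And>t w. 0 \<le> w \<Longrightarrow> \<bar>d_w f t w\<bar> \<le> K"
    unfolding bdd_above_def by fastforce
  have "\<bar>f t a - f t b\<bar> \<le> K * \<bar>a - b\<bar>" if "0 \<le> a" "0 \<le> b" for t a b
  proof -
    have "(f t has_vector_derivative d_w f t w) (at w within {0..})" if "0 \<le> w" for w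
      using diff that unfolding d_w_def deriv_within_def differentiable_on_def
      by (simp add: vector_derivative_works)
    then have "(f t has_field_derivative d_w f t w) (at w within {0..})" if "w \<in> {0..}" for w
      using that by (simp add: has_real_derivative_iff_has_vector_derivative)
    from field_differentiable_bound[OF _ this, of K a b] K that show ?thesis
      by simp
  qed
  then show ?thesis
    using that by blast
qed

text \<open>
  The factor \<open>exp (a t)\<close> absorbs the loss terms \<open>- w\<close> and \<open>f t (u t x) - f t (u t (x + h))\<close>. What
  remains is the gain \<open>J * w \<ge> 0\<close>. So weighted gaps never decrease, and the gap over the source
  interval, which feeds the gap at \<open>x\<close>, persists during the whole step.
\<close>

lemma gap_transfer:
  assumes kernel: "\<And>z. 0 \<le> J z"
    and lip: "\<And>t a b. 0 \<le> a \<Longrightarrow> 0 \<le> b \<Longrightarrow> \<bar>f t a - f t b\<bar> \<le> K * \<bar>a - b\<bar>"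
    and sol: "classical_solution J f UNIV u" and anti: "\<And>t. antimono (u t)"
    and \<kappa>: "\<And>z. z \<in> {\<alpha>..\<beta>} \<Longrightarrow> \<kappa> \<le> J z" and pos: "\<alpha> \<le> \<beta>" "0 \<le> \<kappa>"
    and "0 \<le> \<tau>" "0 \<le> h"
  shows "\<kappa> * \<tau> * exp (- (1 + K) * \<tau>) * h * (u t (x - \<beta> + h) - u t (x - \<alpha>))
      \<le> u (t + \<tau>) x - u (t + \<tau>) (x + h)"
proof -
  have cont: "continuous_on UNIV (u t)" for t
  proof -
    have "continuous_on UNIV (\<lambda>(t, x). u t x)"
      using sol unfolding classical_solution_def by simp
    from continuous_on_compose2[OF this, of UNIV "\<lambda>x. (t, x)"] show ?thesis
      by (simp add: continuous_intros)
  qed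
  have nonneg: "0 \<le> u t x" and int: "integrable lborel (\<lambda>y. J (x - y) * u t y)" for t x
    using sol unfolding classical_solution_def by auto
  have du: "((\<lambda>\<tau>. u \<tau> x) has_real_derivative conv J (u t) x - u t x + f t (u t x)) (at t)" for t x
    using sol unfolding classical_solution_def by (metis UNIV_I)
  define a where "a = 1 + K"
  let ?w = "\<lambda>h x t. u t x - u t (x + h)"
  let ?z = "\<lambda>h x t. exp (a * t) * ?w h x t"
  let ?z' = "\<lambda>h x t. exp (a * t) * (a * ?w h x t + (conv J (u t) x - u t x + f t (u t x)
      - (conv J (u t) (x + h) - u t (x + h) + f t (u t (x + h)))))"
  have dz: "(?z h x has_real_derivative ?z' h x t) (at t)" for h x t
    by (rule derivative_eq_intros du refl | simp)+ (simp add: algebra_simps)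
  have lower: "exp (a * t) * (conv J (u t) x - conv J (u t) (x + h)) \<le> ?z' h x t"
    if "0 \<le> h" for h x t
  proof -
    have "0 \<le> ?w h x t"
      using antimonoD[OF anti, of x "x + h" t] that by simp
    then have "- (K * ?w h x t) \<le> f t (u t x) - f t (u t (x + h))"
      using lip[OF nonneg nonneg, of t t x t "x + h"] by (simp add: abs_le_iff)
    then show ?thesis
      unfolding a_def by (intro mult_left_mono) (auto simp: algebra_simps)
  qed
  have gain: "\<kappa> * h * (u t (x - \<beta> + h) - u t (x - \<alpha>)) \<le> conv J (u t) x - conv J (u t) (x + h)"
    if "0 \<le> h" for h x t
    using that by (intro conv_gap_lower_bound cont anti int kernel \<kappa> pos)
  have conv_mono: "0 \<le> conv J (u t) x - conv J (u t) (x + h)" if "0 \<le> h" for h x t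
    \<comment> \<open>The general bound over the same interval with constant \<open>0\<close>.\<close>
    using conv_gap_lower_bound[OF cont anti int kernel, of \<alpha> \<beta> 0 h t x] pos that kernel by simp
  have z_mono: "?z h x t \<le> ?z h x r" if "0 \<le> h" "t \<le> r" for h x t r
  proof (rule DERIV_nonneg_imp_nondecreasing[OF that(2)])
    fix q
    have "0 \<le> ?z' h x q"
      by (rule order_trans[OF mult_nonneg_nonneg[OF exp_ge_zero conv_mono] lower]) (use that in auto)
    with dz show "\<exists>D. (?z h x has_real_derivative D) (at q) \<and> 0 \<le> D" by blast
  qed
  let ?p = "x - \<beta> + h" and ?q = "x - \<alpha>"
  let ?c = "\<kappa> * h * (exp (a * t) * (u t ?p - u t ?q))"
  have w_nonneg: "0 \<le> ?w h x t"
    using antimonoD[OF anti, of x "x + h" t] assms by simp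
  have main: "?c * \<tau> \<le> exp (a * (t + \<tau>)) * ?w h x (t + \<tau>)"
  proof (cases "?p \<le> ?q")
    case True
    have rate: "?c \<le> ?z' h x r" if "t \<le> r" for r
    proof -
      have "exp (a * t) * (u t ?p - u t ?q) \<le> exp (a * r) * (u r ?p - u r ?q)"
        using z_mono[of "?q - ?p" t r ?p] True that by simp
      then have "?c \<le> \<kappa> * h * (exp (a * r) * (u r ?p - u r ?q))"
        using assms by (intro mult_left_mono) auto
      also have "\<dots> = exp (a * r) * (\<kappa> * h * (u r ?p - u r ?q))"
        by simp
      also have "\<dots> \<le> exp (a * r) * (conv J (u r) x - conv J (u r) (x + h))"
        using gain[OF \<open>0 \<le> h\<close>] by (intro mult_left_mono) auto
      also note lower[OF \<open>0 \<le> h\<close>]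
      finally show ?thesis .
    qed
    have "?z h x t - ?c * t \<le> ?z h x (t + \<tau>) - ?c * (t + \<tau>)"
    proof (rule DERIV_nonneg_imp_nondecreasing[of t "t + \<tau>" "\<lambda>r. ?z h x r - ?c * r"])
      fix r assume r: "t \<le> r"
      have "((\<lambda>r. ?z h x r - ?c * r) has_real_derivative ?z' h x r - ?c) (at r)"
        by (rule DERIV_diff[OF dz]) (rule DERIV_cmult_Id)
      moreover have "0 \<le> ?z' h x r - ?c"
        using rate[OF r] by linarith
      ultimately show "\<exists>D. ((\<lambda>r. ?z h x r - ?c * r) has_real_derivative D) (at r) \<and> 0 \<le> D"
        by (intro exI conjI)
    qed (use assms in auto)
    moreover have "0 \<le> ?z h x t"
      using w_nonneg by simp
    ultimately show ?thesis
      by (simp only: distrib_left)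
  next
    case False
    \<comment> \<open>The source interval is empty, and the bound only says that gaps are nonnegative.\<close>
    then have "u t ?p - u t ?q \<le> 0"
      using antimonoD[OF anti, of ?q ?p t] by simp
    then have "?c * \<tau> \<le> 0"
      using assms by (intro mult_nonpos_nonneg mult_nonneg_nonpos) (auto simp: mult_nonneg_nonpos)
    moreover have "0 \<le> exp (a * (t + \<tau>)) * ?w h x (t + \<tau>)"
      using antimonoD[OF anti, of x "x + h" "t + \<tau>"] assms by simp
    ultimately show ?thesis
      by linarith
  qed
  have "\<kappa> * \<tau> * exp (- a * \<tau>) * h * (u t ?p - u t ?q)
      = exp (- a * (t + \<tau>)) * (?c * \<tau>)"
    using exp_add[of "- a * (t + \<tau>)" "a * t"] by (simp add: algebra_simps)
  also have "\<dots> \<le> exp (- a * (t + \<tau>)) * (exp (a * (t + \<tau>)) * ?w h x (t + \<tau>))"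
    using main by (intro mult_left_mono) auto
  also have "\<dots> = ?w h x (t + \<tau>)"
    by (simp add: mult.assoc[symmetric] flip: exp_add)
  finally show ?thesis
    unfolding a_def .
qed

section \<open>Spreading of gaps in space\<close>

text \<open>
  The gap at \<open>x\<close> is fed by the gap over a part of \<open>[x + \<alpha>, x + \<beta>]\<close> one step before, and gaps there are
  fed by those displaced back by amounts in \<open>[\<alpha>, \<beta>]\<close>. Cutting this intermediate interval of length \<open>4 \<delta>\<close> into pieces of length
  \<open>\<delta>\<close> and using its first or its last usable piece reaches the two sides of \<open>x\<close>.
\<close>

lemma gap_double_step:
  fixes u :: "real \<Rightarrow> real \<Rightarrow> real"
  assumes anti: "\<And>t. antimono (u t)" and pos: "0 < c" "0 < \<delta>" and \<delta>: "\<beta> = \<alpha> + 4 * \<delta>"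
    and right: "\<And>t x h. 0 < h \<Longrightarrow>
      c * h * (u t (x + \<alpha> + h) - u t (x + \<beta>)) \<le> u (t + \<tau>) x - u (t + \<tau>) (x + h)"
    and left: "\<And>t x h. 0 < h \<Longrightarrow>
      c * h * (u t (x - \<beta> + h) - u t (x - \<alpha>)) \<le> u (t + \<tau>) x - u (t + \<tau>) (x + h)"
    and h: "0 < h" "h \<le> \<delta>"
  shows "c\<^sup>2 * \<delta> / 2 * h * (u t (x - 2 * \<delta>) - u t (x + 2 * \<delta>))
      \<le> u (t + 2 * \<tau>) x - u (t + 2 * \<tau>) (x + h)"
proof -
  note D = antimonoD[OF anti]
  have two: "c * h * (c * \<delta> * (u t (x' - \<beta> + \<delta>) - u t (x' - \<alpha>)))
      \<le> u (t + 2 * \<tau>) x - u (t + 2 * \<tau>) (x + h)"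
    if "x + \<alpha> + h \<le> x'" "x' + \<delta> \<le> x + \<beta>" for x'
  proof -
    have "c * \<delta> * (u t (x' - \<beta> + \<delta>) - u t (x' - \<alpha>)) \<le> u (t + \<tau>) x' - u (t + \<tau>) (x' + \<delta>)"
      by (rule left[OF pos(2)])
    also have "\<dots> \<le> u (t + \<tau>) (x + \<alpha> + h) - u (t + \<tau>) (x + \<beta>)"
      using D[OF that(1), of "t + \<tau>"] D[OF that(2), of "t + \<tau>"] by simp
    finally have "c * h * (c * \<delta> * (u t (x' - \<beta> + \<delta>) - u t (x' - \<alpha>)))
        \<le> c * h * (u (t + \<tau>) (x + \<alpha> + h) - u (t + \<tau>) (x + \<beta>))"
      using pos h by (intro mult_left_mono) auto
    also note right[OF h(1)]
    finally show ?thesis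
      by (simp add: algebra_simps)
  qed
  have "c * h * (c * \<delta> * (u t x - u t (x + 3 * \<delta>)))
      \<le> u (t + 2 * \<tau>) x - u (t + 2 * \<tau>) (x + h)"
    using two[of "x + \<alpha> + 3 * \<delta>"] h unfolding \<delta> by (simp add: algebra_simps)
  moreover have "c * h * (c * \<delta> * (u t (x - 2 * \<delta>) - u t (x + \<delta>)))
      \<le> u (t + 2 * \<tau>) x - u (t + 2 * \<tau>) (x + h)"
    using two[of "x + \<alpha> + \<delta>"] h pos unfolding \<delta> by (simp add: algebra_simps)
  moreover have "c * h * (c * \<delta> * (u t (x - 2 * \<delta>) - u t (x + 2 * \<delta>)))
      \<le> c * h * (c * \<delta> * (u t x - u t (x + 3 * \<delta>)))
        + c * h * (c * \<delta> * (u t (x - 2 * \<delta>) - u t (x + \<delta>)))"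
    unfolding distrib_left[symmetric]
    using pos h D[of x "x + \<delta>" t] D[of "x + 2 * \<delta>" "x + 3 * \<delta>" t]
    by (intro mult_left_mono) auto
  ultimately show ?thesis
    by (simp add: power2_eq_square algebra_simps)
qed

text \<open>
  The last double step sees in particular the pieces \<open>[x - \<delta>, x]\<close> and \<open>[x + \<delta>, x + 2 \<delta>]\<close>. The
  intervals that control these two by induction, centred at \<open>x - \<delta>\<close> and \<open>x + \<delta>\<close>, overlap, and
  their union reaches one more \<open>\<delta>\<close> to each side of \<open>x\<close>.
\<close>

lemma gap_spreading:
  fixes u :: "real \<Rightarrow> real \<Rightarrow> real"
  assumes anti: "\<And>t. antimono (u t)" and pos: "0 < k" "0 < \<delta>"
    and step: "\<And>t x h. 0 < h \<Longrightarrow> h \<le> \<delta> \<Longrightarrow>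
      k * h * (u t (x - 2 * \<delta>) - u t (x + 2 * \<delta>)) \<le> u (t + \<sigma>) x - u (t + \<sigma>) (x + h)"
  shows "\<exists>k'>0. \<forall>t x h. 0 < h \<and> h \<le> \<delta> \<longrightarrow>
      k' * h * (u t (x - real (Suc n) * \<delta>) - u t (x + real (Suc n) * \<delta>))
        \<le> u (t + real (Suc n) * \<sigma>) x - u (t + real (Suc n) * \<sigma>) (x + h)"
proof (induction n)
  note D = antimonoD[OF anti]
  case 0
  have "k * h * (u t (x - \<delta>) - u t (x + \<delta>)) \<le> u (t + \<sigma>) x - u (t + \<sigma>) (x + h)"
    if "0 < h" "h \<le> \<delta>" for t x h
  proof -
    have "k * h * (u t (x - \<delta>) - u t (x + \<delta>)) \<le> k * h * (u t (x - 2 * \<delta>) - u t (x + 2 * \<delta>))"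
      using D[of "x - 2 * \<delta>" "x - \<delta>" t] D[of "x + \<delta>" "x + 2 * \<delta>" t] pos that
      by (intro mult_left_mono) auto
    with step[OF that, of t x] show ?thesis by linarith
  qed
  with pos show ?case by auto
next
  note D = antimonoD[OF anti]
  case (Suc n)
  define m where "m = real (Suc n)"
  have m: "1 \<le> m" "real (Suc (Suc n)) = m + 1"
    by (auto simp: m_def)
  obtain k' where k': "0 < k'" and IH: "\<And>t x h. 0 < h \<Longrightarrow> h \<le> \<delta> \<Longrightarrow>
      k' * h * (u t (x - m * \<delta>) - u t (x + m * \<delta>)) \<le> u (t + m * \<sigma>) x - u (t + m * \<sigma>) (x + h)"
    using Suc unfolding m_def by blast
  have "k * k' * \<delta> / 2 * h * (u t (x - (m + 1) * \<delta>) - u t (x + (m + 1) * \<delta>))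
      \<le> u (t + (m + 1) * \<sigma>) x - u (t + (m + 1) * \<sigma>) (x + h)"
    if h: "0 < h" "h \<le> \<delta>" for t x h
  proof -
    let ?s = "t + m * \<sigma>"
    let ?W = "u ?s (x - 2 * \<delta>) - u ?s (x + 2 * \<delta>)"
    have "k' * \<delta> * (u t (x - (m + 1) * \<delta>) - u t (x - \<delta> + m * \<delta>)) \<le> u ?s (x - \<delta>) - u ?s x"
      using IH[of \<delta> t "x - \<delta>"] pos by (simp add: algebra_simps)
    also have "\<dots> \<le> ?W"
      using D[of "x - 2 * \<delta>" "x - \<delta>" ?s] D[of x "x + 2 * \<delta>" ?s] pos by simp
    finally have l: "k' * \<delta> * (u t (x - (m + 1) * \<delta>) - u t (x - \<delta> + m * \<delta>)) \<le> ?W" .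
    have "k' * \<delta> * (u t (x + \<delta> - m * \<delta>) - u t (x + (m + 1) * \<delta>)) \<le> u ?s (x + \<delta>) - u ?s (x + 2 * \<delta>)"
      using IH[of \<delta> t "x + \<delta>"] pos by (simp add: algebra_simps)
    also have "\<dots> \<le> ?W"
      using D[of "x - 2 * \<delta>" "x + \<delta>" ?s] pos by simp
    finally have r: "k' * \<delta> * (u t (x + \<delta> - m * \<delta>) - u t (x + (m + 1) * \<delta>)) \<le> ?W" .
    have "\<delta> \<le> m * \<delta>"
      using m(1) pos by simp
    then have overlap: "u t (x - \<delta> + m * \<delta>) \<le> u t (x + \<delta> - m * \<delta>)"
      by (intro D) linarith
    have "k' * \<delta> * (u t (x - (m + 1) * \<delta>) - u t (x + (m + 1) * \<delta>))
        \<le> k' * \<delta> * ((u t (x - (m + 1) * \<delta>) - u t (x - \<delta> + m * \<delta>))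
          + (u t (x + \<delta> - m * \<delta>) - u t (x + (m + 1) * \<delta>)))"
      using overlap k' pos by (intro mult_left_mono) auto
    also have "\<dots> \<le> 2 * ?W"
      using add_mono[OF l r] by (simp only: distrib_left mult_2)
    finally have "k * h * (k' * \<delta> * (u t (x - (m + 1) * \<delta>) - u t (x + (m + 1) * \<delta>))) \<le> k * h * (2 * ?W)"
      using pos h by (intro mult_left_mono) auto
    then have "k * k' * \<delta> / 2 * h * (u t (x - (m + 1) * \<delta>) - u t (x + (m + 1) * \<delta>)) \<le> k * h * ?W"
      by (simp add: mult_ac)
    also have "k * h * ?W \<le> u (?s + \<sigma>) x - u (?s + \<sigma>) (x + h)"
      by (rule step[OF h])
    finally show ?thesis
      by (simp add: algebra_simps)
  qed
  moreover have "0 < k * k' * \<delta> / 2"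
    using pos k' by simp
  ultimately show ?case
    unfolding m(2) by blast
qed

section \<open>Steepness of the front\<close>

lemma exp_bounds_half_gap:
  assumes "0 < cm" "0 < cp" "0 < hm" "0 < hp"
  obtains H where
    "\<And>g \<xi>. exp_bounds cm cp hm hp g \<xi> \<Longrightarrow> 1 / 2 \<le> g (\<xi> - H) - g (\<xi> + H)"
proof -
  \<comment> \<open>Far enough to make both exponentials at most \<open>1 / 4\<close>.\<close>
  define H where "H = hm + ln 4 / cm + (hp + ln 4 / cp)"
  have ln4: "0 < ln (4::real)" by simp
  have "0 < ln 4 / cm" "0 < ln 4 / cp"
    using assms ln4 by simp_all
  then have H: "ln 4 / cm \<le> H - hm" "ln 4 / cp \<le> H - hp" "hm \<le> H" "hp \<le> H"
    using assms unfolding H_def by linarith+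
  have quarter: "exp (- c * d) \<le> 1 / 4" if "0 < c" "ln 4 / c \<le> d" for c d :: real
  proof -
    have "ln 4 \<le> c * d"
      using that by (simp add: field_simps)
    then have "exp (- c * d) \<le> exp (- ln (4::real))"
      by simp
    then show ?thesis
      by (simp add: exp_minus)
  qed
  have "1 / 2 \<le> g (\<xi> - H) - g (\<xi> + H)" if "exp_bounds cm cp hm hp g \<xi>" for g \<xi>
  proof -
    have "\<forall>x \<le> \<xi> - hm. 1 - exp (cm * (x - \<xi> + hm)) \<le> g x"
      using that unfolding exp_bounds_def by blast
    then have "1 - exp (cm * (\<xi> - H - \<xi> + hm)) \<le> g (\<xi> - H)"
      using H(3) by (elim allE[of _ "\<xi> - H"]) simp
    moreover have "\<forall>x \<ge> \<xi> + hp. g x \<le> exp (- cp * (x - \<xi> - hp))"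
      using that unfolding exp_bounds_def by blast
    then have "g (\<xi> + H) \<le> exp (- cp * (\<xi> + H - \<xi> - hp))"
      using H(4) by (elim allE[of _ "\<xi> + H"]) simp
    moreover have "cm * (\<xi> - H - \<xi> + hm) = - cm * (H - hm)"
      by (simp add: algebra_simps)
    ultimately show ?thesis
      using quarter[OF assms(1) H(1)] quarter[OF assms(2) H(2)] by simp
  qed
  then show ?thesis using that by blast
qed

theorem theorem1p3:
  fixes J :: "real \<Rightarrow> real"
    and f :: "real \<Rightarrow> real \<Rightarrow> real" and fmin :: "real \<Rightarrow> real" and \<theta> :: real
    and \<phi> :: "real \<Rightarrow> real" and c_star :: real
    and y :: "real \<Rightarrow> real"
    and v :: "real \<Rightarrow> real \<Rightarrow> real \<Rightarrow> real" and Y :: "real \<Rightarrow> real \<Rightarrow> real"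
    and cmin cmax cm cp hm hp :: real
    and u :: "real \<Rightarrow> real \<Rightarrow> real" and X :: "real \<Rightarrow> real"
    and M :: real
  assumes "dispersal_kernel J"
    and "ignition_nonlinearity f \<theta> fmin"
    and "minimal_wave J fmin \<theta> c_star \<phi>"
    and "approximating_solutions J f \<theta> \<phi> y v"
    and "approximating_interfaces v Y cmin cmax cm cp hm hp"
    and "transition_front J f u"
    and "front_limit v Y u X"
    and "front_properties u X cmin cmax cm cp hm hp"
    and "M > 0"
  shows "(SUP t. SUP x\<in>{X t - M..X t + M}. ereal (deriv (u t) x)) < 0"
proof -
  obtain \<alpha> \<beta> \<kappa> where J: "\<alpha> < \<beta>" "0 < \<kappa>"
    "\<And>z. z \<in> {\<alpha>..\<beta>} \<Longrightarrow> \<kappa> \<le> J z" "\<And>z. z \<in> {-\<beta>..-\<alpha>} \<Longrightarrow> \<kappa> \<le> J z"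
    using dispersal_kernel_positive_on_interval[OF assms(1)] by blast
  have J_nonneg: "0 \<le> J z" for z
    using assms(1) unfolding dispersal_kernel_def by blast
  obtain K where lip: "\<And>t a b. 0 \<le> a \<Longrightarrow> 0 \<le> b \<Longrightarrow> \<bar>f t a - f t b\<bar> \<le> K * \<bar>a - b\<bar>"
    using ignition_nonlinearity_lipschitz[OF assms(2)] by blast
  have sol: "classical_solution J f UNIV u"
    using assms(6) unfolding transition_front_def by blast
  have X: "X C1_differentiable_on UNIV" "\<And>t. deriv X t \<in> {cmin..cmax}"
    and strict: "\<And>t. strict_antimono_on UNIV (u t)"
    and exps: "\<And>t. exp_bounds cm cp hm hp (u t) (X t)"
    and u_C1: "\<And>t. u t C1_differentiable_on UNIV"
    using assms(8) unfolding front_properties_def by blast+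
  have rates: "0 < cmin" "0 < cm" "0 < cp" "0 < hm" "0 < hp"
    using assms(5) unfolding approximating_interfaces_def by blast+
  have anti: "antimono (u t)" for t
  proof (rule antimonoI)
    fix p q :: real assume "p \<le> q"
    then show "u t q \<le> u t p"
      using monotone_onD[OF strict[of t], of p q] by (cases "p = q") auto
  qed
  obtain H where H: "\<And>g \<xi>. exp_bounds cm cp hm hp g \<xi> \<Longrightarrow> 1 / 2 \<le> g (\<xi> - H) - g (\<xi> + H)"
    using exp_bounds_half_gap[OF rates(2-5)] by blast
  define \<delta> where "\<delta> = (\<beta> - \<alpha>) / 4"
  have \<delta>: "0 < \<delta>" "\<beta> = \<alpha> + 4 * \<delta>"
    using J(1) by (auto simp: \<delta>_def field_simps)
  obtain n where "(M + H + cmax) / \<delta> \<le> real n"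
    using real_arch_simple by blast
  then have n: "M + H + cmax \<le> real (Suc n) * \<delta>"
    using \<delta>(1) by (simp add: field_simps)
  \<comment> \<open>With \<open>n\<close> fixed, the steps are made so short that all double steps together take unit time.\<close>
  define \<tau> where "\<tau> = 1 / (2 * real (Suc n))"
  have \<tau>: "0 < \<tau>" "real (Suc n) * (2 * \<tau>) = 1"
    by (auto simp: \<tau>_def)
  define c where "c = \<kappa> * \<tau> * exp (- (1 + K) * \<tau>)"
  have c: "0 < c"
    using J \<tau> by (simp add: c_def)
  have "c\<^sup>2 * \<delta> / 2 * h * (u t (x - 2 * \<delta>) - u t (x + 2 * \<delta>))
      \<le> u (t + 2 * \<tau>) x - u (t + 2 * \<tau>) (x + h)" if "0 < h" "h \<le> \<delta>" for t x h
  proof (rule gap_double_step[OF anti c \<delta> _ _ that])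
    fix t x h :: real assume h: "0 < h"
    show "c * h * (u t (x + \<alpha> + h) - u t (x + \<beta>)) \<le> u (t + \<tau>) x - u (t + \<tau>) (x + h)"
      using gap_transfer[OF J_nonneg lip sol anti J(4),
          where t = t and x = x and h = h and \<tau> = \<tau> and \<alpha> = "- \<beta>" and \<beta> = "- \<alpha>"] J \<tau> h
      by (simp add: c_def)
    show "c * h * (u t (x - \<beta> + h) - u t (x - \<alpha>)) \<le> u (t + \<tau>) x - u (t + \<tau>) (x + h)"
      using gap_transfer[OF J_nonneg lip sol anti J(3),
          where t = t and x = x and h = h and \<tau> = \<tau> and \<alpha> = \<alpha> and \<beta> = \<beta>] J \<tau> h
      by (simp add: c_def)
  qed
  from gap_spreading[where u = u and k = "c\<^sup>2 * \<delta> / 2" and \<sigma> = "2 * \<tau>", OF anti _ \<delta>(1) this, of n] c \<delta>(1) \<tau>(2)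
  obtain k where k: "0 < k" and spread: "\<And>t x h. 0 < h \<Longrightarrow> h \<le> \<delta> \<Longrightarrow>
      k * h * (u t (x - real (Suc n) * \<delta>) - u t (x + real (Suc n) * \<delta>)) \<le> u (t + 1) x - u (t + 1) (x + h)"
    by auto
  have slope: "deriv (u t) x \<le> - (k / 2)" if x: "x \<in> {X t - M..X t + M}" for t x
  proof -
    have "X differentiable (at r)" for r
      using X(1) by (simp add: C1_differentiable_on_eq)
    then have dX: "(X has_real_derivative deriv X r) (at r)" for r
      using DERIV_deriv_iff_real_differentiable by blast
    obtain r where "X t - X (t - 1) = (t - (t - 1)) * deriv X r"
      using MVT2[of "t - 1" t X "deriv X"] dX by auto
    then have "X (t - 1) \<le> X t" "X t \<le> X (t - 1) + cmax"
      using X(2)[of r] rates(1) by auto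
    with n x have zone: "x - real (Suc n) * \<delta> \<le> X (t - 1) - H" "X (t - 1) + H \<le> x + real (Suc n) * \<delta>"
      by (auto simp del: of_nat_Suc)
    have wide: "1 / 2 \<le> u (t - 1) (x - real (Suc n) * \<delta>) - u (t - 1) (x + real (Suc n) * \<delta>)"
      using H[OF exps[of "t - 1"]] antimonoD[OF anti zone(1), of "t - 1"]
        antimonoD[OF anti zone(2), of "t - 1"] by linarith
    have quot: "(u t (x + h) - u t x) / h \<le> - (k / 2)" if h: "0 < h" "h \<le> \<delta>" for h
    proof -
      have "k * h * (1 / 2) \<le> k * h * (u (t - 1) (x - real (Suc n) * \<delta>) - u (t - 1) (x + real (Suc n) * \<delta>))"
        using wide k h by (intro mult_left_mono) auto
      also have "\<dots> \<le> u t x - u t (x + h)"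
        using spread[OF h, of "t - 1" x] by simp
      finally show ?thesis
        using h by (simp add: field_simps)
    qed
    have "u t differentiable (at x)"
      using u_C1[of t] by (simp add: C1_differentiable_on_eq)
    then have "(u t has_real_derivative deriv (u t) x) (at x)"
      using DERIV_deriv_iff_real_differentiable by blast
    then have "((\<lambda>h. (u t (x + h) - u t x) / h) \<longlongrightarrow> deriv (u t) x) (at_right 0)"
      unfolding DERIV_def by (rule filterlim_at_split[THEN iffD1, THEN conjunct2])
    moreover have "eventually (\<lambda>h. (u t (x + h) - u t x) / h \<le> - (k / 2)) (at_right 0)"
      unfolding eventually_at_right_field using \<delta>(1) quot by (intro exI[of _ \<delta>]) auto
    ultimately show ?thesis
      by (intro tendsto_upperbound) auto
  qed
  have "(SUP t. SUP x\<in>{X t - M..X t + M}. ereal (deriv (u t) x)) \<le> ereal (- (k / 2))"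
    by (intro SUP_least) (use slope in simp)
  also have "\<dots> < 0"
    using k by simp
  finally show ?thesis .
qed

end
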